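(* Let $n$ and $k$ be nonnegative integers, and let $G$ be an $(n+k+3)$-connected graph. If the isolated toughness of $G$ satisfies $I(G)>\frac{n+k+4}{k+3}$, then $G$ is $(\mathcal{F},n)$-factor critical avoidable, where $\mathcal{F}=\{K_2\}\cup\{C_j : j\geq 3\}$. That is, for every $S\subseteq V(G)$ with $|S|=n$ and every edge $e\in E(G-S)$, the graph $G-S-e$ has a spanning subgraph each of whose components is isomorphic to $K_2$ or to a cycle $C_j$ for some $j\geq 3$.
   Context: All graphs are finite, simple and undirected. For $S\subseteq V(G)$, $G-S$ is the subgraph of $G$ induced by $V(G)\setminus S$; for an edge $e$, $G-e$ is obtained by deleting $e$ (keeping its endpoints). $i(G-S)$ denotes the number of isolated vertices of $G-S$. $C_j$ is the cycle on $j$ vertices. Isolated toughness: $I(G)=+\infty$ if $G$ is complete; otherwise $I(G)=\min\left\{\frac{|S|}{i(G-S)} : S\subseteq V(G),\ i(G-S)\geq 2\right\}$. For a family $\mathcal{F}$ of graphs, an $\mathcal{F}$-factor of a graph $G$ is a spanning subgraph of $G$ each of whose components is (isomorphic to) an element of $\mathcal{F}$. $G$ is $\mathcal{F}$-factor avoidable if $G-e$ has an $\mathcal{F}$-factor for every $e\in E(G)$. $G$ is $(\mathcal{F},n)$-factor critical avoidable if $G-S$ is $\mathcal{F}$-factor avoidable for every $S\subseteq V(G)$ with $|S|=n$. *)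

theory Defs
  imports
    "Graph_Theory.Graph_Theory"
    "HOL-Library.Extended_Real"
begin

text \<open>
  A finite simple undirected graph is represented, as in the Graph-Theory library, by a finite
  symmetric digraph without loops and parallel arcs (locale \<open>graph\<close>): the edge \<open>{u, v}\<close> is the pair
  of opposite arcs with ends \<open>(u, v)\<close> and \<open>(v, u)\<close>.
\<close>

definition del_verts :: "('a, 'b) pre_digraph \<Rightarrow> 'a set \<Rightarrow> ('a, 'b) pre_digraph" where
  "del_verts G S = G \<restriction> (verts G - S)"

text \<open>Deletes the undirected edge that contains the arc \<open>a\<close>, i.e. both of its orientations.\<close>

definition del_edge :: "('a, 'b) pre_digraph \<Rightarrow> 'b \<Rightarrow> ('a, 'b) pre_digraph" where
  "del_edge G a = G\<lparr>arcs := {b \<in> arcs G.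
     arc_to_ends G b \<noteq> (tail G a, head G a) \<and> arc_to_ends G b \<noteq> (head G a, tail G a)}\<rparr>"

text \<open>A graph on \<open>r\<close> or fewer vertices is never \<open>r\<close>-connected; in particular the complete graph on
  \<open>m\<close> vertices is \<open>(m - 1)\<close>-connected but not \<open>m\<close>-connected.\<close>

definition vertex_connected :: "nat \<Rightarrow> ('a, 'b) pre_digraph \<Rightarrow> bool" where
  "vertex_connected r G \<longleftrightarrow> r < card (verts G) \<and>
     (\<forall>S \<subseteq> verts G. card S < r \<longrightarrow> Digraph_Component.connected (del_verts G S))"

definition isolated_verts :: "('a, 'b) pre_digraph \<Rightarrow> 'a set" where
  "isolated_verts G = {v \<in> verts G. in_arcs G v = {} \<and> out_arcs G v = {}}"

definition num_isolated :: "('a, 'b) pre_digraph \<Rightarrow> nat" where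
  "num_isolated G = card (isolated_verts G)"

text \<open>The minimum is over a finite set; it is nonempty if \<open>G\<close> is not complete, as deleting all
  vertices but two nonadjacent ones leaves two isolated vertices.\<close>

definition isolated_toughness :: "('a, 'b) pre_digraph \<Rightarrow> ereal" where
  "isolated_toughness G =
     (if complete_digraph (card (verts G)) G then \<infinity>
      else Min {ereal (real (card S) / real (num_isolated (del_verts G S))) | S.
                  S \<subseteq> verts G \<and> num_isolated (del_verts G S) \<ge> 2})"

text \<open>As \<open>H\<close> is symmetric, its strongly connected components (\<open>sccs\<close>) are the connected components
  of the undirected graph, and \<open>digraph_iso\<close> is isomorphism of undirected graphs.\<close>

definition has_factor :: "('c, 'd) pre_digraph set \<Rightarrow> ('a, 'b) pre_digraph \<Rightarrow> bool" where
  "has_factor \<F> G \<longleftrightarrow> (\<exists>H. Digraph.graph H \<and> spanning H G \<and>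
     (\<forall>C \<in> pre_digraph.sccs H. \<exists>M \<in> \<F>. digraph_iso C M))"

definition factor_avoidable :: "('c, 'd) pre_digraph set \<Rightarrow> ('a, 'b) pre_digraph \<Rightarrow> bool" where
  "factor_avoidable \<F> G \<longleftrightarrow> (\<forall>e \<in> arcs G. has_factor \<F> (del_edge G e))"

definition factor_critical_avoidable ::
    "('c, 'd) pre_digraph set \<Rightarrow> nat \<Rightarrow> ('a, 'b) pre_digraph \<Rightarrow> bool" where
  "factor_critical_avoidable \<F> n G \<longleftrightarrow>
     (\<forall>S \<subseteq> verts G. card S = n \<longrightarrow> factor_avoidable \<F> (del_verts G S))"

text \<open>The cycle \<open>C\<^sub>j\<close> on the vertices \<open>0, \<dots>, j - 1\<close>; meaningful for \<open>j \<ge> 3\<close>.\<close>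

definition cycle_graph :: "nat \<Rightarrow> nat pair_pre_digraph" where
  "cycle_graph j = \<lparr>pverts = {..<j},
     parcs = {(u, v). u < j \<and> v < j \<and> (v = Suc u mod j \<or> u = Suc v mod j)}\<rparr>"

text \<open>The first part consists of all copies of \<open>K\<^sub>2\<close> with vertices in \<open>nat\<close>. As factors are
  defined up to isomorphism, this is the same as including a single copy.\<close>

definition K2_cycles :: "(nat, nat \<times> nat) pre_digraph set" where
  "K2_cycles = {K. complete_digraph 2 K} \<union> {with_proj (cycle_graph j) | j. j \<ge> 3}"

end

theory Submission
  imports Defs
begin

text \<open>
  If \<open>i(H - T) \<le> |T|\<close> for all \<open>T\<close>, then Hall's theorem yields a permutation \<open>\<sigma>\<close> of the vertices of
  \<open>H\<close> that moves every vertex to a neighbour; the edges \<open>v \<sigma>(v)\<close> form a factor whose components, the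
  orbits of \<open>\<sigma>\<close>, are copies of \<open>K\<^sub>2\<close> and cycles. So suppose that \<open>i(G - S - e - T) > |T|\<close>. As the minimum
  degree of \<open>G\<close> is at least \<open>n + k + 3\<close> and \<open>e\<close> contributes at most one neighbour to each of its two
  ends, \<open>|T| \<ge> k + 2\<close>. Hence some vertex outside \<open>e\<close> is isolated, and \<open>|T| \<ge> k + 3\<close>. Deleting an end
  of \<open>e\<close> as well shows \<open>I(G) \<le> (n + |T| + 1) / |T| \<le> (n + k + 4) / (k + 3)\<close>.
\<close>

section \<open>Hall's marriage theorem\<close>

text \<open>Induction on \<open>card V\<close>. If some nonempty proper \<open>A\<close> is tight,
  \<open>A\<close> and \<open>V - A\<close> are matched separately, the latter avoiding all
  neighbours of \<open>A\<close>. If none is tight, every nonempty proper subset has one neighbour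
  to spare, so any single pair may be matched and removed.\<close>

lemma hall_marriage:
  assumes "finite V" "\<And>x. x \<in> V \<Longrightarrow> finite (N x)"
    and "\<And>A. A \<subseteq> V \<Longrightarrow> card A \<le> card (\<Union>x\<in>A. N x)"
  shows "\<exists>f. inj_on f V \<and> (\<forall>x\<in>V. f x \<in> N x)"
  using assms
proof (induction "card V" arbitrary: V N rule: less_induct)
  case less
  note fin = less.prems(1,2) and hall = less.prems(3)
  show ?case
  proof (cases "\<exists>A. A \<noteq> {} \<and> A \<subset> V \<and> card (\<Union>x\<in>A. N x) = card A")
    case True
    then obtain A where A: "A \<noteq> {}" "A \<subset> V" "card (\<Union>x\<in>A. N x) = card A" by blast
    let ?U = "\<Union>x\<in>A. N x"
    have finA: "finite A" using A fin(1) finite_subset by blast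
    have "card A < card V" using A fin(1) by (simp add: psubset_card_mono)
    then obtain f where f: "inj_on f A" "\<forall>x\<in>A. f x \<in> N x"
      using less.hyps[of A N] A finA fin(2) hall by (metis psubsetD psubset_imp_subset subset_trans)
    have "card (V - A) < card V"
      using A fin(1) by (intro psubset_card_mono) auto
    \<comment> \<open>Hall's condition for \<open>A \<union> B\<close> minus the equality for
      \<open>A\<close> leaves the condition for \<open>B\<close>.\<close>
    moreover have "card B \<le> card (\<Union>x\<in>B. N x - ?U)" if "B \<subseteq> V - A" for B
    proof -
      have finB: "finite B" using that fin(1) finite_subset by blast
      have "card A + card B = card (A \<union> B)"
        using that finA finB by (subst card_Un_disjoint) auto
      also have "\<dots> \<le> card (\<Union>x\<in>A \<union> B. N x)" using hall that A by blast
      also have "(\<Union>x\<in>A \<union> B. N x) = ?U \<union> (\<Union>x\<in>B. N x - ?U)" by auto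
      also have "card \<dots> \<le> card ?U + card (\<Union>x\<in>B. N x - ?U)" by (rule card_Un_le)
      finally show ?thesis using A(3) by simp
    qed
    ultimately obtain g where g: "inj_on g (V - A)" "\<forall>x\<in>V - A. g x \<in> N x - ?U"
      using less.hyps[of "V - A" "\<lambda>x. N x - ?U"] fin by auto
    let ?h = "\<lambda>x. if x \<in> A then f x else g x"
    have "f x \<noteq> g y" if "x \<in> A" "y \<in> V - A" for x y using that f g by (metis DiffD2 UN_I)
    then have "inj_on ?h V"
      using f(1) g(1) unfolding inj_on_def by (metis DiffI)
    moreover have "\<forall>x\<in>V. ?h x \<in> N x" using f g by auto
    ultimately show ?thesis by blast
  next
    case False
    show ?thesis
    proof (cases "V = {}")
      case False
      then obtain x where x: "x \<in> V" by blast
      have "N x \<noteq> {}" using hall[of "{x}"] x by auto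
      then obtain y where y: "y \<in> N x" by blast
      have "card (V - {x}) < card V" using fin(1) x by (rule card_Diff1_less)
      moreover have "card B \<le> card (\<Union>z\<in>B. N z - {y})" if B: "B \<subseteq> V - {x}" for B
      proof (cases "B = {}")
        case False
        have "B \<subset> V" using B x by blast
        then have "card B < card (\<Union>z\<in>B. N z)"
          using False \<open>\<not> (\<exists>A. _ A)\<close> hall[of B] by (metis le_neq_implies_less psubset_imp_subset)
        moreover have "card ((\<Union>z\<in>B. N z) - {y}) \<ge> card (\<Union>z\<in>B. N z) - 1"
          by (metis One_nat_def card.empty card_insert_disjoint diff_card_le_card_Diff
              empty_iff finite.emptyI finite.insertI)
        ultimately have "card B \<le> card ((\<Union>z\<in>B. N z) - {y})" by linarith
        then show ?thesis by simp
      qed simp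
      ultimately obtain g where g: "inj_on g (V - {x})" "\<forall>z\<in>V - {x}. g z \<in> N z - {y}"
        using less.hyps[of "V - {x}" "\<lambda>z. N z - {y}"] fin by auto
      have "inj_on (g(x := y)) V"
        using g unfolding inj_on_def by (auto simp: fun_upd_def)
      moreover have "\<forall>z\<in>V. (g(x := y)) z \<in> N z" using g y by auto
      ultimately show ?thesis by blast
    qed simp
  qed
qed

section \<open>Deletion of vertices and edges\<close>

lemma verts_del_verts [simp]: "verts (del_verts G T) = verts G - T"
  by (simp add: del_verts_def)

lemma arcs_ends_del_verts:
  assumes "wf_digraph G"
  shows "arcs_ends (del_verts G T) = {(x, y) \<in> arcs_ends G. x \<notin> T \<and> y \<notin> T}"
proof -
  interpret wf_digraph G by fact
  show ?thesis by (fastforce simp: del_verts_def arcs_ends_conv)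
qed

lemma graph_del_verts:
  assumes "Digraph.graph G"
  shows "Digraph.graph (del_verts G T)"
proof -
  interpret Digraph.graph G by fact
  have ind: "induced_subgraph (del_verts G T) G"
    unfolding del_verts_def by (rule induced_induce) auto
  interpret D: digraph "del_verts G T" using ind by (rule digraphI_induced)
  show ?thesis using induced_graph_imp_symmetric[OF sym_arcs ind] by (rule D.graphI)
qed

lemma verts_del_edge [simp]: "verts (del_edge G a) = verts G"
  by (simp add: del_edge_def)

lemma arcs_ends_del_edge:
  "arcs_ends (del_edge G a) = arcs_ends G - {(tail G a, head G a), (head G a, tail G a)}"
  by (auto simp: del_edge_def arcs_ends_def arc_to_ends_def)

lemma graph_restrict_arcs:
  assumes "Digraph.graph G" "A \<subseteq> arcs G" "symmetric (G\<lparr>arcs := A\<rparr>)"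
  shows "Digraph.graph (G\<lparr>arcs := A\<rparr>)"
proof -
  interpret Digraph.graph G by fact
  have "finite A" using assms(2) by (rule finite_subset) simp
  then show ?thesis
    using assms(2,3) no_loops
    by unfold_locales (auto simp: arc_to_ends_def subset_iff intro: no_multi_arcs)
qed

lemma graph_del_edge:
  assumes "Digraph.graph G"
  shows "Digraph.graph (del_edge G a)"
proof -
  interpret Digraph.graph G by fact
  have "symmetric (del_edge G a)"
    using sym_arcs unfolding symmetric_def arcs_ends_del_edge by (auto simp: sym_def)
  then show ?thesis unfolding del_edge_def by (intro graph_restrict_arcs assms) auto
qed

text \<open>By symmetry a vertex without outgoing arcs has no incoming ones, so out-neighbours alone
  decide isolation.\<close>

lemma isolated_verts_del_verts:
  assumes "Digraph.graph G"
  shows "isolated_verts (del_verts G T) =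
    {v \<in> verts G - T. \<forall>w. v \<rightarrow>\<^bsub>G\<^esub> w \<longrightarrow> w \<in> T}"
proof -
  interpret D: Digraph.graph "del_verts G T" using assms by (rule graph_del_verts)
  interpret Digraph.graph G by fact
  have "in_arcs (del_verts G T) v = {} \<and> out_arcs (del_verts G T) v = {} \<longleftrightarrow>
      (\<forall>w. \<not> v \<rightarrow>\<^bsub>del_verts G T\<^esub> w)" for v
  proof -
    have "out_arcs (del_verts G T) v = {} \<longleftrightarrow> (\<forall>w. \<not> v \<rightarrow>\<^bsub>del_verts G T\<^esub> w)"
      by (auto simp: out_arcs_def arcs_ends_conv)
    moreover have "in_arcs (del_verts G T) v = {} \<longleftrightarrow> (\<forall>w. \<not> w \<rightarrow>\<^bsub>del_verts G T\<^esub> v)"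
      by (auto simp: in_arcs_def arcs_ends_conv)
    ultimately show ?thesis using arcs_ends_symmetric[OF D.sym_arcs] by blast
  qed
  then show ?thesis
    unfolding isolated_verts_def arcs_ends_del_verts[OF wf_digraph_axioms] by auto
qed

lemma finite_isolated_verts_del_verts:
  "Digraph.graph G \<Longrightarrow> finite (isolated_verts (del_verts G T))"
  by (simp add: isolated_verts_def Digraph.graph_def digraph_def fin_digraph.finite_verts)

subsection \<open>Graphs with a factor\<close>

text \<open>Hall's condition for \<open>A\<close> only needs checking on the part \<open>B\<close>
  of \<open>A\<close> with no neighbour in \<open>A\<close>: deleting the neighbourhood
  \<open>T\<close> of \<open>B\<close> isolates \<open>B\<close>, and \<open>T\<close> lies in
  \<open>?NA - A\<close>. The vertices in \<open>A \<inter> ?NA\<close> count equally on both sides.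
  The resulting injection of a finite set into itself is a permutation.\<close>

lemma neighbour_permutation:
  assumes "Digraph.graph G"
    and tutte: "\<And>T. T \<subseteq> verts G \<Longrightarrow> num_isolated (del_verts G T) \<le> card T"
  obtains \<sigma> where "\<sigma> permutes verts G" "\<And>v. v \<in> verts G \<Longrightarrow> v \<rightarrow>\<^bsub>G\<^esub> \<sigma> v"
proof -
  interpret Digraph.graph G by fact
  let ?N = "\<lambda>v. {w. v \<rightarrow>\<^bsub>G\<^esub> w}"
  have N: "?N v \<subseteq> verts G" for v by (auto dest: adj_in_verts)
  have finN: "finite (?N v)" for v using finite_subset[OF N finite_verts] .
  have "card A \<le> card (\<Union>v\<in>A. ?N v)" if A: "A \<subseteq> verts G" for A
  proof -
    let ?NA = "\<Union>v\<in>A. ?N v"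
    define B where "B = A - ?NA"
    define T where "T = (\<Union>v\<in>B. ?N v)"
    have finA: "finite A" using finite_subset[OF A finite_verts] .
    have finNA: "finite ?NA" using finA finN by blast
    \<comment> \<open>If a neighbour of some \<open>b\<close> in \<open>B\<close> lay in
      \<open>A\<close>, symmetry would put \<open>b\<close> into \<open>?NA\<close>.\<close>
    have T: "T \<subseteq> ?NA - A"
      using sym_arcs unfolding T_def B_def symmetric_def sym_def by blast
    have "T \<subseteq> verts G" unfolding T_def using N by blast
    have "B \<subseteq> isolated_verts (del_verts G T)"
      using T A by (auto simp: isolated_verts_del_verts[OF assms(1)] B_def T_def)
    then have "card B \<le> card T"
      using tutte[OF \<open>T \<subseteq> verts G\<close>] card_mono[OF finite_isolated_verts_del_verts[OF assms(1)]]
      unfolding num_isolated_def by (meson order_trans)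
    also have "\<dots> \<le> card (?NA - A)" using T finNA by (intro card_mono) auto
    finally have "card B + card (A \<inter> ?NA) \<le> card (?NA - A) + card (A \<inter> ?NA)" by simp
    moreover have "card B + card (A \<inter> ?NA) = card A"
      unfolding B_def using finA by (metis add.commute card_Int_Diff)
    moreover have "card (?NA - A) + card (A \<inter> ?NA) = card ?NA"
      using finNA by (metis add.commute card_Int_Diff Int_commute)
    ultimately show ?thesis by simp
  qed
  then obtain f where f: "inj_on f (verts G)" "\<forall>v\<in>verts G. v \<rightarrow>\<^bsub>G\<^esub> f v"
    using hall_marriage[of "verts G" ?N] finN by auto
  define \<sigma> where "\<sigma> v = (if v \<in> verts G then f v else v)" for v
  have inj: "inj_on \<sigma> (verts G)" using f(1) by (simp add: \<sigma>_def inj_on_def)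
  moreover have "\<sigma> ` verts G \<subseteq> verts G" using f(2) by (auto simp: \<sigma>_def dest: adj_in_verts)
  ultimately have "\<sigma> ` verts G = verts G" by (simp add: endo_inj_surj)
  then have "\<sigma> permutes verts G"
    using inj by (intro bij_imp_permutes) (auto simp: bij_betw_def \<sigma>_def)
  then show thesis using that f(2) by (simp add: \<sigma>_def)
qed

section \<open>Orbits of a permutation as cycles\<close>

lemma digraph_iso_cycle_graph:
  assumes "nomulti_digraph C" and h: "bij_betw h {..<m} (verts C)"
    and adj: "\<And>i j. i < m \<Longrightarrow> j < m \<Longrightarrow>
      h i \<rightarrow>\<^bsub>C\<^esub> h j \<longleftrightarrow> j = Suc i mod m \<or> i = Suc j mod m"
  shows "digraph_iso C (with_proj (cycle_graph m))"
proof -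
  interpret nomulti_digraph C by fact
  define g where "g = the_inv_into {..<m} h"
  have g: "bij_betw g (verts C) {..<m}" unfolding g_def using h by (rule bij_betw_the_inv_into)
  have gh: "g (h i) = i" if "i < m" for i
    using that h unfolding g_def bij_betw_def by (simp add: the_inv_into_f_f)
  have hg: "h (g x) = x" if "x \<in> verts C" for x
    using that h unfolding g_def by (simp add: f_the_inv_into_f_bij_betw)
  have gm: "g x < m" if "x \<in> verts C" for x using that g by (auto simp: bij_betw_def)
  \<comment> \<open>Arcs of \<open>with_proj\<close> are pairs of vertices, so each arc is renamed
    to the pair of indices of its ends; this is injective because there are no parallel
    arcs.\<close>
  let ?iso = "\<lparr>iso_verts = g, iso_arcs = \<lambda>a. (g (tail C a), g (head C a)),
    iso_head = snd, iso_tail = fst\<rparr>"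
  have "inj_on (\<lambda>a. (g (tail C a), g (head C a))) (arcs C)"
  proof (rule inj_onI)
    fix a b assume "a \<in> arcs C" "b \<in> arcs C"
      "(g (tail C a), g (head C a)) = (g (tail C b), g (head C b))"
    then show "a = b"
      by (intro no_multi_arcs) (auto simp: arc_to_ends_def intro: inj_onD[OF bij_betw_imp_inj_on[OF g]])
  qed
  then have "pre_digraph.digraph_isomorphism C ?iso"
    using g by (simp add: pre_digraph.digraph_isomorphism_def wf_digraph_axioms bij_betw_def)
  moreover have "(\<lambda>a. (g (tail C a), g (head C a))) ` arcs C = parcs (cycle_graph m)"
  proof -
    have "(\<lambda>a. (g (tail C a), g (head C a))) ` arcs C = map_prod g g ` arcs_ends C"
      by (auto simp: arcs_ends_conv image_image)
    also have "\<dots> = {(i, j). i < m \<and> j < m \<and> h i \<rightarrow>\<^bsub>C\<^esub> h j}"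
    proof (intro equalityI subsetI)
      fix p assume "p \<in> map_prod g g ` arcs_ends C"
      then obtain x y where "x \<rightarrow>\<^bsub>C\<^esub> y" "p = (g x, g y)" by auto
      then show "p \<in> {(i, j). i < m \<and> j < m \<and> h i \<rightarrow>\<^bsub>C\<^esub> h j}"
        using adj_in_verts[of x y] by (simp add: gm hg)
    next
      fix p assume "p \<in> {(i, j). i < m \<and> j < m \<and> h i \<rightarrow>\<^bsub>C\<^esub> h j}"
      then obtain i j where "i < m" "j < m" "p = (i, j)" "h i \<rightarrow>\<^bsub>C\<^esub> h j" by auto
      then have "p = map_prod g g (h i, h j)" "h i \<rightarrow>\<^bsub>C\<^esub> h j" by (simp_all add: gh)
      then show "p \<in> map_prod g g ` arcs_ends C" by blast
    qed
    also have "\<dots> = parcs (cycle_graph m)" using adj by (auto simp: cycle_graph_def)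
    finally show ?thesis .
  qed
  then have "with_proj (cycle_graph m) = app_iso ?iso C"
    using g by (simp add: app_iso_def with_proj_def cycle_graph_def bij_betw_def)
  ultimately show ?thesis unfolding digraph_iso_def by blast
qed

text \<open>For \<open>m = 2\<close> the formula for \<open>cycle_graph\<close> degenerates to one
  edge, that is \<open>K2\<close>; orbits of length 2 thus need no separate treatment.\<close>

lemma cycle_graph_in_K2_cycles:
  assumes "m \<ge> 2"
  shows "with_proj (cycle_graph m) \<in> K2_cycles"
proof (cases "m = 2")
  case True
  have "parcs (cycle_graph 2) = {(u, v). u < 2 \<and> v < 2 \<and> u \<noteq> v}"
    by (auto simp: cycle_graph_def less_2_cases_iff)
  then have "complete_digraph 2 (with_proj (cycle_graph 2))"
    by (auto simp: complete_digraph_pair_def cycle_graph_def)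
  then show ?thesis using True by (simp add: K2_cycles_def)
next
  case False
  then show ?thesis using assms by (auto simp: K2_cycles_def)
qed

text \<open>The orbit is listed as the iterates of \<open>\<sigma>\<close> at \<open>u\<close>, and
  \<open>m\<close> is the first positive time of return to \<open>u\<close>. It is not 1, as
  \<open>u\<close> is not fixed.\<close>

lemma orbit_enumeration:
  assumes "permutation \<sigma>" "\<sigma> u \<noteq> u"
  obtains m h where "m \<ge> 2" "bij_betw h {..<m::nat} (orbit \<sigma> u)"
    "\<And>i. i < m \<Longrightarrow> \<sigma> (h i) = h (Suc i mod m)"
proof
  define m where "m = funpow_dist1 \<sigma> u u"
  define h where "h = (\<lambda>i. (\<sigma> ^^ i) u)"
  have u: "u \<in> orbit \<sigma> u" using assms(1) by (rule permutation_self_in_orbit)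
  have period: "(\<sigma> ^^ m) u = u" unfolding m_def using u by (rule funpow_dist1_prop)
  show "bij_betw h {..<m} (orbit \<sigma> u)"
    using inj_on_funpow_dist1[OF u] orbit_conv_funpow_dist1[OF u]
    by (simp add: bij_betw_def h_def m_def lessThan_atLeast0)
  have "m \<noteq> 0" by (simp add: m_def)
  moreover have "m \<noteq> 1" using period assms(2) by auto
  ultimately show "m \<ge> 2" by linarith
  show "\<sigma> (h i) = h (Suc i mod m)" if "i < m" for i
  proof (cases "Suc i = m")
    case True
    then have "\<sigma> (h i) = (\<sigma> ^^ m) u" by (auto simp: h_def)
    then show ?thesis using True period by (simp add: h_def)
  qed (use that in \<open>simp add: h_def\<close>)
qed

text \<open>The edges joining each vertex to its image form the factor \<open>H\<close>. Its
  components are the orbits of \<open>\<sigma>\<close>, on which adjacency means being consecutive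
  in the cyclic order.\<close>

lemma permutation_factor:
  assumes "Digraph.graph G" and perm: "\<sigma> permutes verts G"
    and adj: "\<And>v. v \<in> verts G \<Longrightarrow> v \<rightarrow>\<^bsub>G\<^esub> \<sigma> v"
  shows "has_factor K2_cycles G"
proof -
  interpret Digraph.graph G by fact
  define H where "H = G\<lparr>arcs := {a \<in> arcs G. head G a = \<sigma> (tail G a) \<or> tail G a = \<sigma> (head G a)}\<rparr>"
  have ends0: "arcs_ends H = {(x, y) \<in> arcs_ends G. y = \<sigma> x \<or> x = \<sigma> y}"
    by (auto simp: H_def arcs_ends_conv)
  then have ends: "x \<rightarrow>\<^bsub>H\<^esub> y \<longleftrightarrow> x \<in> verts G \<and> y \<in> verts G \<and> (y = \<sigma> x \<or> x = \<sigma> y)" for x y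
    using adj arcs_ends_symmetric[OF sym_arcs] by (auto dest: adj_in_verts)
  have "symmetric H" unfolding symmetric_def by (rule symI) (auto simp: ends)
  then have gH: "Digraph.graph H"
    unfolding H_def by (intro graph_restrict_arcs assms) auto
  interpret H: Digraph.graph H by fact
  have vH: "verts H = verts G" by (simp add: H_def)
  have "spanning H G"
    using wf_digraph_axioms H.wf_digraph_axioms
    by (auto simp: spanning_def subgraph_def compatible_def H_def)
  have permn: "permutation \<sigma>" using perm finite_verts permutation_permutes by blast
  have scc: "H.scc_of u = orbit \<sigma> u" if u: "u \<in> verts G" for u
  proof -
    have "u \<rightarrow>\<^sup>*\<^bsub>H\<^esub> v" if "v \<in> orbit \<sigma> u" for v
      using that
    proof induction
      case base
      show ?case using u perm by (intro H.reachable_adjI) (simp add: ends permutes_in_image)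
    next
      case (step y)
      have "y \<rightarrow>\<^bsub>H\<^esub> \<sigma> y"
        using H.reachable_in_verts(2)[OF step.IH] perm by (simp add: ends vH permutes_in_image)
      then show ?case using step.IH H.reachable_adj_trans by blast
    qed
    moreover have "v \<in> orbit \<sigma> u" if "u \<rightarrow>\<^sup>*\<^bsub>H\<^esub> v" for v
      using that
    proof (induction rule: H.reachable_induct)
      case base
      show ?case using permn by (rule permutation_self_in_orbit)
    next
      case (step x y)
      show ?case
      proof (cases "y = \<sigma> x")
        case True
        then show ?thesis using step.IH by (simp add: orbit.step)
      next
        case False
        \<comment> \<open>An arc traversed against \<open>\<sigma>\<close> also stays in the orbit,
          since \<open>y\<close> and \<open>\<sigma> y\<close> have the same orbit under a
          permutation.\<close>
        then have "x = \<sigma> y" using step.hyps by (simp add: ends)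
        then have "orbit \<sigma> y = orbit \<sigma> x" using permutation_orbit_step[OF permn] by simp
        then have "y \<in> orbit \<sigma> x" using permutation_self_in_orbit[OF permn] by metis
        then show ?thesis using step.IH by (rule orbit_trans)
      qed
    qed
    ultimately show ?thesis
      using symmetric_reachable[OF H.sym_arcs] unfolding H.scc_of_def by blast
  qed
  have "\<exists>M\<in>K2_cycles. digraph_iso C M" if C: "C \<in> H.sccs" for C
  proof -
    obtain u where u: "u \<in> verts G" and Cu: "C = H \<restriction> orbit \<sigma> u"
      using C by (auto simp: H.sccs_conv_sccs_verts H.sccs_verts_conv_scc_of vH scc)
    \<comment> \<open>Without loops \<open>\<sigma>\<close> has no fixed vertex, which excludes
      components with a single vertex.\<close>
    have "\<sigma> u \<noteq> u" using adj[OF u] adj_not_same by metis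
    with permn obtain m h where m: "m \<ge> 2" and h: "bij_betw h {..<m::nat} (orbit \<sigma> u)"
      and \<sigma>h: "\<And>i. i < m \<Longrightarrow> \<sigma> (h i) = h (Suc i mod m)"
      by (rule orbit_enumeration) blast
    have sub: "orbit \<sigma> u \<subseteq> verts G" using perm u by (rule permutes_orbit_subset)
    interpret C: digraph C
      unfolding Cu using sub by (intro H.digraphI_induced H.induced_induce) (simp add: vH)
    have hin: "h i \<in> orbit \<sigma> u" if "i < m" for i using that h by (auto simp: bij_betw_def)
    have hinj: "h i = h j \<longleftrightarrow> i = j" if "i < m" "j < m" for i j
      using that h by (auto simp: bij_betw_def inj_on_def)
    have endsC: "arcs_ends C = {(x, y) \<in> arcs_ends H. x \<in> orbit \<sigma> u \<and> y \<in> orbit \<sigma> u}"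
      by (auto simp: Cu arcs_ends_conv)
    have "digraph_iso C (with_proj (cycle_graph m))"
    proof (rule digraph_iso_cycle_graph)
      show "nomulti_digraph C" by unfold_locales
      show "bij_betw h {..<m} (verts C)" using h by (simp add: Cu)
      fix i j assume ij: "i < m" "j < m"
      then have "h i \<rightarrow>\<^bsub>C\<^esub> h j \<longleftrightarrow> h j = \<sigma> (h i) \<or> h i = \<sigma> (h j)"
        using hin sub by (auto simp: endsC ends)
      also have "\<dots> \<longleftrightarrow> j = Suc i mod m \<or> i = Suc j mod m"
        using ij m by (simp add: \<sigma>h hinj)
      finally show "h i \<rightarrow>\<^bsub>C\<^esub> h j \<longleftrightarrow> j = Suc i mod m \<or> i = Suc j mod m" .
    qed
    then show ?thesis using cycle_graph_in_K2_cycles[OF m] by blast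
  qed
  then show ?thesis
    unfolding has_factor_def using gH \<open>spanning H G\<close> by blast
qed

lemma has_factorI:
  assumes "Digraph.graph G"
    and "\<And>T. T \<subseteq> verts G \<Longrightarrow> num_isolated (del_verts G T) \<le> card T"
  shows "has_factor K2_cycles G"
  using neighbour_permutation[OF assms] permutation_factor[OF assms(1)] by metis

subsection \<open>Connectivity and isolated toughness\<close>

text \<open>Deleting fewer than \<open>r\<close> vertices that include all neighbours of
  \<open>x\<close> would cut \<open>x\<close> off from some further vertex. Allowing any superset
  \<open>X\<close> of the neighbourhood lets the bound apply directly to the deleted sets.\<close>

lemma vertex_connected_neighbours:
  assumes "Digraph.graph G" "vertex_connected r G"
    and x: "x \<in> verts G" "x \<notin> X" and X: "X \<subseteq> verts G" "\<And>y. x \<rightarrow>\<^bsub>G\<^esub> y \<Longrightarrow> y \<in> X"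
  shows "r \<le> card X"
proof (rule ccontr)
  assume less: "\<not> r \<le> card X"
  interpret Digraph.graph G by fact
  interpret D: Digraph.graph "del_verts G X" using assms(1) by (rule graph_del_verts)
  have "finite X" using finite_subset[OF X(1) finite_verts] .
  \<comment> \<open>\<open>insert x X\<close> has at most \<open>r\<close> elements and
    \<open>G\<close> has more than \<open>r\<close> vertices.\<close>
  then have "card (insert x X) < card (verts G)"
    using less x assms(2) by (simp add: vertex_connected_def)
  then obtain y where y: "y \<in> verts G" "y \<notin> insert x X"
    using \<open>finite X\<close> by (metis card_mono finite_insert not_less subsetI)
  have "Digraph_Component.connected (del_verts G X)"
    using assms(2) less X by (simp add: vertex_connected_def)
  then have "x \<rightarrow>\<^sup>*\<^bsub>mk_symmetric (del_verts G X)\<^esub> y"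
    using x y by (simp add: connected_def strongly_connected_def)
  then have "x \<rightarrow>\<^sup>*\<^bsub>del_verts G X\<^esub> y" using D.reachable_mk_symmetric_eq[OF D.sym_arcs] by blast
  then show False
  proof (cases rule: D.converse_reachable_cases)
    case base
    then show ?thesis using y by simp
  next
    case (step w)
    then show ?thesis using X(2) by (auto simp: arcs_ends_del_verts[OF wf_digraph_axioms])
  qed
qed

text \<open>Two isolated vertices of \<open>del_verts G T\<close> are not adjacent in
  \<open>G\<close>, so \<open>G\<close> is not complete and the minimum over a finite set
  applies.\<close>

lemma isolated_toughness_le:
  assumes "Digraph.graph G" "T \<subseteq> verts G" "num_isolated (del_verts G T) \<ge> 2"
  shows "isolated_toughness G \<le> ereal (real (card T) / real (num_isolated (del_verts G T)))"
proof -
  interpret Digraph.graph G by fact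
  obtain x y where "x \<in> isolated_verts (del_verts G T)" "y \<in> isolated_verts (del_verts G T)" "x \<noteq> y"
    using assms(3) unfolding num_isolated_def
    by (metis One_nat_def card_le_Suc0_iff_eq card.infinite not_less_eq_eq numeral_2_eq_2 zero_le)
  then have "\<not> complete_digraph (card (verts G)) G"
    by (auto simp: isolated_verts_del_verts[OF assms(1)] complete_digraph_def)
  moreover have "finite {ereal (real (card S) / real (num_isolated (del_verts G S))) | S.
      S \<subseteq> verts G \<and> num_isolated (del_verts G S) \<ge> 2}"
    by (rule finite_subset[OF _ finite_imageI[OF finite_Pow_iff[THEN iffD2, OF finite_verts]]])
      (auto simp: image_iff)
  ultimately show ?thesis
    unfolding isolated_toughness_def using assms(2,3) by (auto intro!: Min_le)
qed

section \<open>Violating sets and the toughness bound\<close>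

theorem theorem1p1:
  fixes G :: "('a, 'b) pre_digraph" and n k :: nat
  assumes "Digraph.graph G"
    and "vertex_connected (n + k + 3) G"
    and "isolated_toughness G > ereal ((real n + real k + 4) / (real k + 3))"
  shows "factor_critical_avoidable K2_cycles n G"
  unfolding factor_critical_avoidable_def factor_avoidable_def
proof (intro allI impI ballI)
  fix S e
  assume S: "S \<subseteq> verts G" "card S = n" and e: "e \<in> arcs (del_verts G S)"
  interpret Digraph.graph G by fact
  define H where "H = del_edge (del_verts G S) e"
  have gH: "Digraph.graph H" unfolding H_def by (intro graph_del_edge graph_del_verts assms)
  define u v where "u = tail G e" and "v = head G e"
  have uv: "u \<in> verts G - S" "v \<in> verts G - S" using e by (auto simp: del_verts_def u_def v_def)
  have ends: "arcs_ends H = {(x, y) \<in> arcs_ends G. x \<notin> S \<and> y \<notin> S} - {(u, v), (v, u)}"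
    unfolding H_def arcs_ends_del_edge arcs_ends_del_verts[OF wf_digraph_axioms]
    by (simp add: del_verts_def u_def v_def)
  have "num_isolated (del_verts H T) \<le> card T" if T: "T \<subseteq> verts H" for T
  proof (rule ccontr)
    assume neg: "\<not> num_isolated (del_verts H T) \<le> card T"
    define I where "I = isolated_verts (del_verts H T)"
    define t where "t = card T"
    have It: "card I > t"
      using neg by (simp add: num_isolated_def I_def t_def)
    have I: "I = {x \<in> verts G - S - T. \<forall>w. x \<rightarrow>\<^bsub>H\<^esub> w \<longrightarrow> w \<in> T}"
      unfolding I_def isolated_verts_del_verts[OF gH] by (simp add: H_def)
    have TG: "T \<subseteq> verts G" using T by (auto simp: H_def)
    have fin: "finite S" "finite T" 
      using finite_subset[OF S(1) finite_verts] finite_subset[OF TG finite_verts] by auto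
    have cST: "card (S \<union> T) \<le> n + t" using card_Un_le[of S T] S by (simp add: t_def)
    have nb: "n + k + 3 \<le> card X"
      if "x \<in> I" "X \<subseteq> verts G" "x \<notin> X" "\<And>y. x \<rightarrow>\<^bsub>G\<^esub> y \<Longrightarrow> y \<in> X" for x X
      using that I by (intro vertex_connected_neighbours[OF assms(1,2)]) auto
    have nbI: "y \<in> S \<union> T \<or> (x, y) = (u, v) \<or> (x, y) = (v, u)" if "x \<in> I" "x \<rightarrow>\<^bsub>G\<^esub> y" for x y
      using that unfolding I ends by blast
    obtain x where x: "x \<in> I" using It by fastforce
    \<comment> \<open>If \<open>x\<close> is an end of \<open>e\<close>, then \<open>p\<close> is
      the other end, the only possible neighbour of \<open>x\<close> in \<open>G\<close> outside
      \<open>S \<union> T\<close>. Otherwise \<open>p\<close> is a harmless extra element.\<close>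
    define p where "p = (if x = u then v else u)"
    have "n + k + 3 \<le> card (insert p (S \<union> T))"
    proof (rule nb[OF x])
      show "insert p (S \<union> T) \<subseteq> verts G" using uv S TG by (auto simp: p_def)
      have "u \<noteq> v" using e no_loops by (auto simp: del_verts_def u_def v_def)
      show "x \<notin> insert p (S \<union> T)" using x \<open>u \<noteq> v\<close> by (auto simp: p_def I split: if_splits)
      show "y \<in> insert p (S \<union> T)" if "x \<rightarrow>\<^bsub>G\<^esub> y" for y
        using nbI[OF x that] by (auto simp: p_def)
    qed
    also have "\<dots> \<le> Suc (n + t)" using cST fin by (simp add: card_insert_if)
    finally have "2 \<le> t" by simp
    \<comment> \<open>\<open>I\<close> has more than \<open>t \<ge> 2\<close> elements.\<close>
    then have "\<not> I \<subseteq> {u, v}" using It card_mono[of "{u, v}" I] card_insert_le_m1[of 2 "{v}" u] by auto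
    then obtain z where z: "z \<in> I" "z \<noteq> u" "z \<noteq> v" by blast
    \<comment> \<open>No edge at \<open>z\<close> was lost with \<open>e\<close>, so the bound holds
      without \<open>p\<close> and improves by one.\<close>
    have "n + k + 3 \<le> card (S \<union> T)"
      using nbI[OF z(1)] z S TG by (intro nb[OF z(1)]) (auto simp: I)
    then have t: "k + 3 \<le> t" using cST by simp
    \<comment> \<open>Deleting \<open>u\<close> also destroys \<open>e\<close>, so all of
      \<open>I\<close> except possibly \<open>u\<close> is isolated in \<open>G\<close> minus
      \<open>T'\<close>. As \<open>card I > t\<close>, at least \<open>t\<close> isolated vertices
      remain.\<close>
    define T' where "T' = insert u (S \<union> T)"
    let ?q = "num_isolated (del_verts G T')"
    have "T' \<subseteq> verts G" using uv S TG by (auto simp: T'_def)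
    have "card T' \<le> n + t + 1" using cST fin by (simp add: T'_def card_insert_if)
    have "I - {u} \<subseteq> isolated_verts (del_verts G T')"
      using nbI by (auto simp: isolated_verts_del_verts[OF assms(1)] T'_def I)
    then have "card (I - {u}) \<le> ?q"
      unfolding num_isolated_def
      by (intro card_mono finite_isolated_verts_del_verts assms)
    then have q: "t \<le> ?q" using It by (cases "u \<in> I") (auto simp: card_Diff_singleton_if)
    have "isolated_toughness G \<le> ereal (real (card T') / real ?q)"
      using q t by (intro isolated_toughness_le assms \<open>T' \<subseteq> verts G\<close>) simp
    also have "real (card T') / real ?q \<le> real (n + t + 1) / real t"
      using q t \<open>card T' \<le> n + t + 1\<close> by (intro frac_le) auto
    \<comment> \<open>In this form the ratio visibly decreases in \<open>t\<close>, so its largest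
      value is at \<open>t = k + 3\<close>.\<close>
    also have "\<dots> = 1 + (real n + 1) / real t" using t by (simp add: field_simps)
    also have "\<dots> \<le> 1 + (real n + 1) / (real k + 3)"
      using t by (intro add_left_mono divide_left_mono) auto
    also have "\<dots> = (real n + real k + 4) / (real k + 3)" by (simp add: field_simps)
    finally show False using assms(3) by simp
  qed
  then show "has_factor K2_cycles (del_edge (del_verts G S) e)"
    using gH has_factorI unfolding H_def by blast
qed

end
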